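(* Let $A, B, C$ be finite alphabets, and let $\varphi : A^{+} \to C^{+}$, $\psi : B^{+} \to C^{+}$ be two epimorphisms of semigroups. Let $\varphi' : A^{*}\to C^{*}$ and $\psi' : B^{*}\to C^{*}$ be the extensions of $\varphi,\psi$ to monoid homomorphisms mapping $\varepsilon_A$ and $\varepsilon_B$ to $\varepsilon_C$, and let $\mathcal{A}_{\varphi',\psi'}$ be the two-tape automaton associated to $(\varphi',\psi')$ (defined in the context). Then the language accepted by $\mathcal{A}_{\varphi',\psi'}$ is the set of indecomposable elements of the semigroup $\Pi(\varphi,\psi) = \{(\alpha,\beta)\in A^{+}\times B^{+} : \varphi(\alpha)=\psi(\beta)\}$.
   Context: For an alphabet $A$, $A^{*}$ is the free monoid over $A$ with empty word $\varepsilon_A$, and $A^{+} = A^{*}\setminus\{\varepsilon_A\}$ is the free semigroup. "Epimorphism" means surjective homomorphism. An element $s$ of a semigroup $S$ is indecomposable if there are no $s_1,s_2\in S$ with $s = s_1s_2$. For words, $u \leq_p w$ means $u$ is a prefix of $w$; $u <_s w$ means $u$ is a suffix of $w$ with $u \ne w$; if $u \leq_p w$ then $u^{-1}w$ is the unique word $u'$ with $uu' = w$. A two-tape automaton is a tuple $(Q,\Sigma_1,\Sigma_2,\delta,\iota,F)$ with $Q$ a finite set of states, input alphabets $\Sigma_1,\Sigma_2$, transition relation $\delta \subseteq Q\times\Sigma\times Q$ where $\Sigma = (\Sigma_1\cup\{\varepsilon_1\})\times(\Sigma_2\cup\{\varepsilon_2\})$ ($\varepsilon_1,\varepsilon_2$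 the empty words over $\Sigma_1,\Sigma_2$), initial state $\iota \in Q$ and set of final states $F\subseteq Q$. It accepts an input $(\alpha,\beta)\in\Sigma_1^{*}\times\Sigma_2^{*}$ if there is a finite sequence of transitions $(q_{i-1},\sigma_i,q_i)_{i=1}^{k}$ in $\delta$ with $q_0=\iota$, $q_k\in F$ and $(\alpha,\beta)=\sigma_1\cdots\sigma_k$ (product in $\Sigma_1^{*}\times\Sigma_2^{*}$). The language accepted is the set of all accepted inputs. For epimorphisms $f : A^{*}\to C^{*}$ and $g : B^{*}\to C^{*}$, the automaton $\mathcal{A}_{f,g} = (Q,\Sigma_1,\Sigma_2,\delta,\iota,F)$ is given by: $\Sigma_1 = A$, $\Sigma_2 = B$; $Q = Q_1\cup Q_2\cup\{\iota\}\cup\{(\varepsilon_C,\varepsilon_C)\}$, where $\iota$ is a separate symbol, $Q_1 = \{(u,\varepsilon_C) : u \in C^{+},\ \exists w \in f(A),\ u <_s w\}$, $Q_2 = \{(\varepsilon_C,v) : v \in C^{+},\ \exists w\in g(B),\ v <_s w\}$; $F = \{(\varepsilon_C,\varepsilon_C)\}$; and $\delta = \bigcup_{i=1}^{8}\Delta_i \subseteq Q\times\Sigma\times Q$, where $\Delta_1 = \{(\iota,(a,\varepsilon_B),(\varepsilon_C,\varepsilon_C)) : a\in A,\ f(a)=\varepsilon_C\}$; $\Delta_2 = \{(\iota,(\varepsilon_A,b),(\varepsilon_C,\varepsilon_C)) : b\in B,\ g(b)=\varepsilon_C\}$; $\Delta_3 = \{(\iota,(a,b),(g(b)^{-1}f(a),\varepsilon_C))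 : a\in A, b\in B,\ g(b)\leq_p f(a),\ g(b)\neq\varepsilon_C\}$; $\Delta_4 = \{(\iota,(a,b),(\varepsilon_C,f(a)^{-1}g(b))) : a\in A, b\in B,\ f(a)\leq_p g(b),\ f(a)\neq\varepsilon_C\}$; $\Delta_5 = \{((u,\varepsilon_C),(\varepsilon_A,b),(g(b)^{-1}u,\varepsilon_C)) : b\in B,\ u\neq\varepsilon_C,\ g(b)\leq_p u\}$; $\Delta_6 = \{((u,\varepsilon_C),(\varepsilon_A,b),(\varepsilon_C,u^{-1}g(b))) : b\in B,\ u\neq\varepsilon_C,\ u\leq_p g(b)\}$; $\Delta_7 = \{((\varepsilon_C,v),(a,\varepsilon_B),(\varepsilon_C,f(a)^{-1}v)) : a\in A,\ v\neq\varepsilon_C,\ f(a)\leq_p v\}$; $\Delta_8 = \{((\varepsilon_C,v),(a,\varepsilon_B),(v^{-1}f(a),\varepsilon_C)) : a\in A,\ v\neq\varepsilon_C,\ v\leq_p f(a)\}$ (in $\Delta_5,\Delta_6$ the pair $(u,\varepsilon_C)$ ranges over $Q_1$; in $\Delta_7,\Delta_8$ the pair $(\varepsilon_C,v)$ ranges over $Q_2$). *)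

theory Defs
  imports "HOL-Algebra.Group" "HOL-Library.Sublist"
begin

definition free_monoid :: "'a set \<Rightarrow> 'a list monoid" where
  "free_monoid A = \<lparr>carrier = lists A, mult = (@), one = []\<rparr>"

text \<open>
  The record type of HOL-Algebra forces a value for the field \<open>one\<close>. It lies outside the
  carrier here, and neither \<open>epi\<close> nor \<open>indecomposable\<close> below refers to it.
\<close>

definition free_semigroup :: "'a set \<Rightarrow> 'a list monoid" where
  "free_semigroup A = \<lparr>carrier = lists A - {[]}, mult = (@), one = []\<rparr>"

definition monoid_extension :: "('a list \<Rightarrow> 'c list) \<Rightarrow> 'a list \<Rightarrow> 'c list" where
  "monoid_extension \<phi> = \<phi>([] := [])"

lemma monoid_extension_epi:
  assumes "\<phi> \<in> epi (free_semigroup A) (free_semigroup C)"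
  shows "monoid_extension \<phi> \<in> epi (free_monoid A) (free_monoid C)"
proof -
  have im: "\<phi> ` (lists A - {[]}) = lists C - {[]}"
    and hom: "\<And>x y. \<lbrakk>x \<in> lists A - {[]}; y \<in> lists A - {[]}\<rbrakk> \<Longrightarrow> \<phi> (x @ y) = \<phi> x @ \<phi> y"
    using assms by (auto simp: epi_def hom_def free_semigroup_def)
  have "monoid_extension \<phi> ` lists A
      = insert [] (monoid_extension \<phi> ` (lists A - {[]}))"
    by (force simp: monoid_extension_def)
  also have "monoid_extension \<phi> ` (lists A - {[]}) = \<phi> ` (lists A - {[]})"
    by (rule image_cong) (auto simp: monoid_extension_def)
  finally have im': "monoid_extension \<phi> ` lists A = lists C"
    using im by auto
  have "monoid_extension \<phi> (x @ y) = monoid_extension \<phi> x @ monoid_extension \<phi> y"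
    if "x \<in> lists A" "y \<in> lists A" for x y
    using that hom[of x y] by (auto simp: monoid_extension_def)
  then show ?thesis
    using im' by (auto simp: epi_def hom_def free_monoid_def)
qed

definition indecomposable :: "('s, 'm) monoid_scheme \<Rightarrow> 's \<Rightarrow> bool" where
  "indecomposable S s \<longleftrightarrow>
     s \<in> carrier S \<and> \<not> (\<exists>s\<^sub>1\<in>carrier S. \<exists>s\<^sub>2\<in>carrier S. s = s\<^sub>1 \<otimes>\<^bsub>S\<^esub> s\<^sub>2)"

text \<open>The semigroup \<open>\<Pi>(\<phi>, \<psi>)\<close>, as a subsemigroup of the direct product.\<close>

definition fibre_product ::
  "'a set \<Rightarrow> 'b set \<Rightarrow> ('a list \<Rightarrow> 'c list) \<Rightarrow> ('b list \<Rightarrow> 'c list) \<Rightarrow> ('a list \<times> 'b list) monoid" where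
  "fibre_product A B \<phi> \<psi> =
     (free_semigroup A \<times>\<times> free_semigroup B)
       \<lparr>carrier := {(\<alpha>, \<beta>). \<alpha> \<in> carrier (free_semigroup A) \<and> \<beta> \<in> carrier (free_semigroup B)
                             \<and> \<phi> \<alpha> = \<psi> \<beta>}\<rparr>"

text \<open>
  A letter of \<open>(\<Sigma>\<^sub>1 \<union> {\<epsilon>\<^sub>1}) \<times> (\<Sigma>\<^sub>2 \<union> {\<epsilon>\<^sub>2})\<close> is encoded as a pair of words of length at most one,
  so that the product of letters in \<open>\<Sigma>\<^sub>1\<^sup>* \<times> \<Sigma>\<^sub>2\<^sup>*\<close> is componentwise concatenation.
\<close>

record ('q, 'a, 'b) two_tape =
  states :: "'q set"
  alphabet\<^sub>1 :: "'a set"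
  alphabet\<^sub>2 :: "'b set"
  trans :: "('q \<times> ('a list \<times> 'b list) \<times> 'q) set"
  initial :: 'q
  final :: "'q set"

definition opt_letters :: "'a set \<Rightarrow> 'a list set" where
  "opt_letters A = insert [] ((\<lambda>a. [a]) ` A)"

locale two_tape_automaton =
  fixes M :: "('q, 'a, 'b) two_tape"
  assumes "finite (states M)"
    and "finite (alphabet\<^sub>1 M)"
    and "finite (alphabet\<^sub>2 M)"
    and "trans M \<subseteq> states M
           \<times> (opt_letters (alphabet\<^sub>1 M) \<times> opt_letters (alphabet\<^sub>2 M)) \<times> states M"
    and "initial M \<in> states M"
    and "final M \<subseteq> states M"

definition accepts :: "('q, 'a, 'b) two_tape \<Rightarrow> 'a list \<times> 'b list \<Rightarrow> bool" where
  "accepts M = (\<lambda>(\<alpha>, \<beta>). \<exists>qs \<sigma>s.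
     length qs = Suc (length \<sigma>s) \<and>
     qs ! 0 = initial M \<and>
     qs ! length \<sigma>s \<in> final M \<and>
     (\<forall>i<length \<sigma>s. (qs ! i, \<sigma>s ! i, qs ! Suc i) \<in> trans M) \<and>
     \<alpha> = concat (map fst \<sigma>s) \<and> \<beta> = concat (map snd \<sigma>s))"

definition language :: "('q, 'a, 'b) two_tape \<Rightarrow> ('a list \<times> 'b list) set" where
  "language M = {w \<in> lists (alphabet\<^sub>1 M) \<times> lists (alphabet\<^sub>2 M). accepts M w}"

definition left_quotient :: "'c list \<Rightarrow> 'c list \<Rightarrow> 'c list" where
  "left_quotient u w = (THE u'. u @ u' = w)"

lemma left_quotient_append [simp]: "left_quotient u (u @ v) = v"
  by (simp add: left_quotient_def)

text \<open>
  \<open>Rest u v\<close> is the state written \<open>(u, v)\<close> on paper; \<open>Init\<close> is the separate symbol \<open>\<iota>\<close>.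
  For a letter \<open>a\<close>, the image written \<open>f(a)\<close> on paper is \<open>f [a]\<close>.
\<close>

datatype 'c state = Init | Rest "'c list" "'c list"

definition Q\<^sub>1 :: "'a set \<Rightarrow> 'c set \<Rightarrow> ('a list \<Rightarrow> 'c list) \<Rightarrow> 'c state set" where
  "Q\<^sub>1 A C f = {Rest u [] |u. u \<in> lists C - {[]} \<and> (\<exists>a\<in>A. strict_suffix u (f [a]))}"

definition Q\<^sub>2 :: "'b set \<Rightarrow> 'c set \<Rightarrow> ('b list \<Rightarrow> 'c list) \<Rightarrow> 'c state set" where
  "Q\<^sub>2 B C g = {Rest [] v |v. v \<in> lists C - {[]} \<and> (\<exists>b\<in>B. strict_suffix v (g [b]))}"

definition transitions ::
  "'a set \<Rightarrow> 'b set \<Rightarrow> 'c set \<Rightarrow> ('a list \<Rightarrow> 'c list) \<Rightarrow> ('b list \<Rightarrow> 'c list)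
     \<Rightarrow> ('c state \<times> ('a list \<times> 'b list) \<times> 'c state) set" where
  "transitions A B C f g =
     {(Init, ([a], []), Rest [] []) |a. a \<in> A \<and> f [a] = []} \<union>
     {(Init, ([], [b]), Rest [] []) |b. b \<in> B \<and> g [b] = []} \<union>
     {(Init, ([a], [b]), Rest (left_quotient (g [b]) (f [a])) []) |a b.
        a \<in> A \<and> b \<in> B \<and> prefix (g [b]) (f [a]) \<and> g [b] \<noteq> []} \<union>
     {(Init, ([a], [b]), Rest [] (left_quotient (f [a]) (g [b]))) |a b.
        a \<in> A \<and> b \<in> B \<and> prefix (f [a]) (g [b]) \<and> f [a] \<noteq> []} \<union>
     {(Rest u [], ([], [b]), Rest (left_quotient (g [b]) u) []) |u b.
        Rest u [] \<in> Q\<^sub>1 A C f \<and> b \<in> B \<and> u \<noteq> [] \<and> prefix (g [b]) u} \<union>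
     {(Rest u [], ([], [b]), Rest [] (left_quotient u (g [b]))) |u b.
        Rest u [] \<in> Q\<^sub>1 A C f \<and> b \<in> B \<and> u \<noteq> [] \<and> prefix u (g [b])} \<union>
     {(Rest [] v, ([a], []), Rest [] (left_quotient (f [a]) v)) |v a.
        Rest [] v \<in> Q\<^sub>2 B C g \<and> a \<in> A \<and> v \<noteq> [] \<and> prefix (f [a]) v} \<union>
     {(Rest [] v, ([a], []), Rest (left_quotient v (f [a])) []) |v a.
        Rest [] v \<in> Q\<^sub>2 B C g \<and> a \<in> A \<and> v \<noteq> [] \<and> prefix v (f [a])}"

definition fibre_automaton ::
  "'a set \<Rightarrow> 'b set \<Rightarrow> 'c set \<Rightarrow> ('a list \<Rightarrow> 'c list) \<Rightarrow> ('b list \<Rightarrow> 'c list)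
     \<Rightarrow> ('c state, 'a, 'b) two_tape" where
  "fibre_automaton A B C f g =
     \<lparr>states = Q\<^sub>1 A C f \<union> Q\<^sub>2 B C g \<union> {Init} \<union> {Rest [] []},
      alphabet\<^sub>1 = A,
      alphabet\<^sub>2 = B,
      trans = transitions A B C f g,
      initial = Init,
      final = {Rest [] []}\<rparr>"

lemma finite_strict_suffixes: "finite {u. strict_suffix u w}"
proof (rule finite_subset)
  show "{u. strict_suffix u w} \<subseteq> set (suffixes w)"
    by (auto simp: strict_suffix_def)
qed simp

lemma two_tape_automaton_fibre_automaton:
  assumes "finite A" and "finite B"
    and f: "f \<in> epi (free_monoid A) (free_monoid C)"
    and g: "g \<in> epi (free_monoid B) (free_monoid C)"
  shows "two_tape_automaton (fibre_automaton A B C f g)"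
proof
  have fC: "f [a] \<in> lists C" if "a \<in> A" for a
    using f that by (auto simp: epi_def hom_def free_monoid_def Pi_iff simp del: in_lists_conv_set)
  have gC: "g [b] \<in> lists C" if "b \<in> B" for b
    using g that by (auto simp: epi_def hom_def free_monoid_def Pi_iff simp del: in_lists_conv_set)
  have "Q\<^sub>1 A C f \<subseteq> (\<lambda>u. Rest u []) ` (\<Union>a\<in>A. {u. strict_suffix u (f [a])})"
    by (auto simp: Q\<^sub>1_def)
  then have fin1: "finite (Q\<^sub>1 A C f)"
    by (rule finite_subset) (use assms in \<open>auto intro: finite_strict_suffixes\<close>)
  have "Q\<^sub>2 B C g \<subseteq> (\<lambda>u. Rest [] u) ` (\<Union>b\<in>B. {u. strict_suffix u (g [b])})"
    by (auto simp: Q\<^sub>2_def)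
  then have fin2: "finite (Q\<^sub>2 B C g)"
    by (rule finite_subset) (use assms in \<open>auto intro: finite_strict_suffixes\<close>)
  show "finite (states (fibre_automaton A B C f g))"
    using fin1 fin2 by (simp add: fibre_automaton_def)
  have suf: "suffix v (u @ v)" for u v :: "'c list"
    by (simp add: suffix_def)
  have R1: "Rest v [] \<in> Q\<^sub>1 A C f \<union> {Rest [] []}"
    if "a \<in> A" "u \<noteq> []" "suffix (u @ v) (f [a])" for a u v
    using that fC[of a] unfolding Q\<^sub>1_def
    by (auto simp: strict_suffix_def suffix_def intro!: bexI[of _ a])
  have R2: "Rest [] v \<in> Q\<^sub>2 B C g \<union> {Rest [] []}"
    if "b \<in> B" "u \<noteq> []" "suffix (u @ v) (g [b])" for b u v
    using that gC[of b] unfolding Q\<^sub>2_def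
    by (auto simp: strict_suffix_def suffix_def intro!: bexI[of _ b])
  have S1: "Rest v [] \<in> Q\<^sub>1 A C f \<union> {Rest [] []}"
    if "Rest (u @ v) [] \<in> Q\<^sub>1 A C f" for u v
    using that suf[of v u] unfolding Q\<^sub>1_def
    by (auto intro: suffix_order.le_less_trans)
  have S2: "Rest [] v \<in> Q\<^sub>2 B C g \<union> {Rest [] []}"
    if "Rest [] (u @ v) \<in> Q\<^sub>2 B C g" for u v
    using that suf[of v u] unfolding Q\<^sub>2_def
    by (auto intro: suffix_order.le_less_trans)
  show "trans (fibre_automaton A B C f g) \<subseteq> states (fibre_automaton A B C f g)
      \<times> (opt_letters (alphabet\<^sub>1 (fibre_automaton A B C f g))
          \<times> opt_letters (alphabet\<^sub>2 (fibre_automaton A B C f g)))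
      \<times> states (fibre_automaton A B C f g)"
    unfolding fibre_automaton_def transitions_def opt_letters_def two_tape.simps
    apply (intro Un_least subsetI)
           apply (clarsimp)
          apply (clarsimp)
         apply (clarsimp elim!: prefixE, use R1 in fastforce)
        apply (clarsimp elim!: prefixE, use R2 in fastforce)
       apply (clarsimp elim!: prefixE, use S1 in fastforce)
      apply (clarsimp elim!: prefixE, use R2 in fastforce)
     apply (clarsimp elim!: prefixE, use S2 in fastforce)
    apply (clarsimp elim!: prefixE, use R1 in fastforce)
    done
qed (use assms in \<open>auto simp: fibre_automaton_def\<close>)

end

theory Submission
  imports Defs
begin

text \<open>
  The automaton reads a pair \<open>(\<alpha>, \<beta>)\<close> and remembers only by how much the image of the part read
  on one tape overhangs the image of the part read on the other. In a state with overhang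
  \<open>(u, v)\<close>, where \<open>u\<close> or \<open>v\<close> is empty, the remaining words must satisfy \<open>u @ f \<alpha> = v @ g \<beta>\<close>.
  The final state is the one with overhang \<open>([], [])\<close> and has no outgoing transition, so a run
  that has started stops at the first moment when both images agree. As \<open>f\<close> and \<open>g\<close> erase no
  letter, a factorisation of \<open>(\<alpha>, \<beta>)\<close> inside the fibre product is exactly such an agreement
  strictly between the start and the end. Hence a pair is accepted when its images agree at the
  end and nowhere in between.

  The predicate \<open>first_match u v \<alpha> \<beta>\<close> expresses this for a run that is under way with overhang
  \<open>(u, v)\<close>. It obeys the same one-letter recursion as acceptance: if, say, \<open>u\<close> is non-empty,
  then no match is possible before the second tape moves on, and after reading \<open>b\<close> the common
  prefix of \<open>u\<close> and \<open>g [b]\<close> cancels, leaving the overhang that the transition stores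
  (\<open>first_match_pending_left\<close>, \<open>first_match_pending_right\<close>). An induction on the number of unread
  letters identifies the two (\<open>accepted_from_Rest_iff\<close>), and one more cancellation for the initial
  transition turns \<open>first_match\<close> into indecomposability (\<open>indecomposable_Cons_iff\<close>).
\<close>

section \<open>Acceptance by recursion along a run\<close>

inductive accepted_from :: "('q, 'a, 'b) two_tape \<Rightarrow> 'q \<Rightarrow> 'a list \<Rightarrow> 'b list \<Rightarrow> bool"
  for M where
  stop: "q \<in> final M \<Longrightarrow> accepted_from M q [] []"
| step: "(q, (x, y), q') \<in> trans M \<Longrightarrow> accepted_from M q' \<alpha> \<beta> \<Longrightarrow> accepted_from M q (x @ \<alpha>) (y @ \<beta>)"

lemma accepted_from_if_run:
  assumes "length qs = Suc (length \<sigma>s)" and "qs ! length \<sigma>s \<in> final M"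
    and "\<forall>i<length \<sigma>s. (qs ! i, \<sigma>s ! i, qs ! Suc i) \<in> trans M"
  shows "accepted_from M (qs ! 0) (concat (map fst \<sigma>s)) (concat (map snd \<sigma>s))"
  using assms
proof (induction \<sigma>s arbitrary: qs)
  case Nil
  then show ?case by (simp add: accepted_from.stop)
next
  case (Cons \<sigma> \<sigma>s)
  from Cons.prems(1) obtain q qs' where qs: "qs = q # qs'" "length qs' = Suc (length \<sigma>s)"
    by (cases qs) auto
  have "\<forall>i<length \<sigma>s. (qs' ! i, \<sigma>s ! i, qs' ! Suc i) \<in> trans M"
    using Cons.prems(3) qs by auto
  moreover have "qs' ! length \<sigma>s \<in> final M"
    using Cons.prems(2) qs by simp
  ultimately have "accepted_from M (qs' ! 0) (concat (map fst \<sigma>s)) (concat (map snd \<sigma>s))"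
    using Cons.IH qs(2) by blast
  moreover have "(q, (fst \<sigma>, snd \<sigma>), qs' ! 0) \<in> trans M"
    using Cons.prems(3) qs by force
  ultimately show ?case
    using accepted_from.step qs(1) by fastforce
qed

lemma run_if_accepted_from:
  assumes "accepted_from M q \<alpha> \<beta>"
  shows "\<exists>qs \<sigma>s. length qs = Suc (length \<sigma>s) \<and> qs ! 0 = q \<and> qs ! length \<sigma>s \<in> final M \<and>
     (\<forall>i<length \<sigma>s. (qs ! i, \<sigma>s ! i, qs ! Suc i) \<in> trans M) \<and>
     \<alpha> = concat (map fst \<sigma>s) \<and> \<beta> = concat (map snd \<sigma>s)"
  using assms
proof induction
  case (stop q)
  then show ?case by (intro exI[of _ "[q]"] exI[of _ "[]"]) simp
next
  case (step q x y q' \<alpha> \<beta>)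
  then obtain qs \<sigma>s where run: "length qs = Suc (length \<sigma>s)" "qs ! 0 = q'"
      "qs ! length \<sigma>s \<in> final M" "\<forall>i<length \<sigma>s. (qs ! i, \<sigma>s ! i, qs ! Suc i) \<in> trans M"
      "\<alpha> = concat (map fst \<sigma>s)" "\<beta> = concat (map snd \<sigma>s)"
    by blast
  have "((q # qs) ! i, ((x, y) # \<sigma>s) ! i, (q # qs) ! Suc i) \<in> trans M"
    if "i < length ((x, y) # \<sigma>s)" for i
    using that run step.hyps by (cases i) auto
  with run show ?case
    by (intro exI[of _ "q # qs"] exI[of _ "(x, y) # \<sigma>s"]) simp
qed

lemma accepts_iff_accepted_from: "accepts M (\<alpha>, \<beta>) \<longleftrightarrow> accepted_from M (initial M) \<alpha> \<beta>"
proof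
  assume "accepts M (\<alpha>, \<beta>)"
  then show "accepted_from M (initial M) \<alpha> \<beta>"
    unfolding accepts_def using accepted_from_if_run by fastforce
next
  assume "accepted_from M (initial M) \<alpha> \<beta>"
  then show "accepts M (\<alpha>, \<beta>)"
    unfolding accepts_def using run_if_accepted_from by fastforce
qed

section \<open>Overhangs\<close>

text \<open>
  Here \<open>u\<close> and \<open>v\<close> are what remains of \<open>x\<close> and \<open>y\<close> after cancelling the shorter word from the
  longer one. The equation is cross-wise because \<open>u\<close> must be put back after \<open>y\<close> to recover \<open>x\<close>;
  it can hold only if \<open>x\<close> and \<open>y\<close> are comparable for the prefix order.
\<close>

definition overhang :: "'c list \<Rightarrow> 'c list \<Rightarrow> 'c list \<Rightarrow> 'c list \<Rightarrow> bool" where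
  "overhang x y u v \<longleftrightarrow> (u = [] \<or> v = []) \<and> x @ v = y @ u"

lemma overhang_cancel:
  assumes "overhang x y u v"
  shows "x @ w = y @ z \<longleftrightarrow> u @ w = v @ z"
proof -
  from assms consider "v = []" "x = y @ u" | "u = []" "y = x @ v"
    by (auto simp: overhang_def)
  then show ?thesis by cases auto
qed

lemma ex_overhang:
  assumes "x @ w = y @ z"
  obtains u v where "overhang x y u v"
proof -
  from assms consider r where "x = y @ r" | r where "y = x @ r"
    by (auto simp: append_eq_append_conv2)
  then show thesis
  proof cases
    case (1 r)
    then show thesis using that[of r "[]"] by (simp add: overhang_def)
  next
    case (2 r)
    then show thesis using that[of "[]" r] by (simp add: overhang_def)
  qed
qed

text \<open>
  The two quotients by which the automaton updates its state are the two ways in which one of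
  two comparable words can overhang the other.
\<close>

lemma overhang_iff_left_quotient:
  "overhang x y u v \<longleftrightarrow>
     prefix y x \<and> u = left_quotient y x \<and> v = [] \<or>
     prefix x y \<and> u = [] \<and> v = left_quotient x y"
  by (auto simp: overhang_def prefix_def)

section \<open>The automaton of a pair of non-erasing homomorphisms\<close>

locale nonerasing_pair =
  fixes A :: "'a set" and B :: "'b set" and C :: "'c set"
    and f :: "'a list \<Rightarrow> 'c list" and g :: "'b list \<Rightarrow> 'c list"
  assumes finite_A: "finite A" and finite_B: "finite B"
    and f_epi: "f \<in> epi (free_monoid A) (free_monoid C)"
    and g_epi: "g \<in> epi (free_monoid B) (free_monoid C)"
    and f_eq_Nil_iff: "\<alpha> \<in> lists A \<Longrightarrow> f \<alpha> = [] \<longleftrightarrow> \<alpha> = []"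
    and g_eq_Nil_iff: "\<beta> \<in> lists B \<Longrightarrow> g \<beta> = [] \<longleftrightarrow> \<beta> = []"
begin

abbreviation "M \<equiv> fibre_automaton A B C f g"

lemma f_append: "\<alpha> \<in> lists A \<Longrightarrow> \<alpha>' \<in> lists A \<Longrightarrow> f (\<alpha> @ \<alpha>') = f \<alpha> @ f \<alpha>'"
  using f_epi by (auto simp: epi_def hom_def free_monoid_def simp del: in_lists_conv_set)

lemma g_append: "\<beta> \<in> lists B \<Longrightarrow> \<beta>' \<in> lists B \<Longrightarrow> g (\<beta> @ \<beta>') = g \<beta> @ g \<beta>'"
  using g_epi by (auto simp: epi_def hom_def free_monoid_def simp del: in_lists_conv_set)

lemma f_Cons: "a \<in> A \<Longrightarrow> \<alpha> \<in> lists A \<Longrightarrow> f (a # \<alpha>) = f [a] @ f \<alpha>"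
  using f_append[of "[a]" \<alpha>] by simp

lemma g_Cons: "b \<in> B \<Longrightarrow> \<beta> \<in> lists B \<Longrightarrow> g (b # \<beta>) = g [b] @ g \<beta>"
  using g_append[of "[b]" \<beta>] by simp

lemma f_Nil: "f [] = []" and g_Nil: "g [] = []"
  using f_eq_Nil_iff[of "[]"] g_eq_Nil_iff[of "[]"] by simp_all

lemma trans_target_in_states: "(q, \<sigma>, q') \<in> trans M \<Longrightarrow> q' \<in> states M"
  using two_tape_automaton_fibre_automaton[OF finite_A finite_B f_epi g_epi]
  by (auto simp: two_tape_automaton_def)

lemma final_M: "final M = {Rest [] []}" and initial_M: "initial M = Init"
  by (simp_all add: fibre_automaton_def)

text \<open>
  Since no image of a letter is empty, the transitions that read a single letter in the initial
  state do not occur here.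
\<close>

lemma trans_Init_iff:
  "(Init, (x, y), q) \<in> trans M \<longleftrightarrow>
     (\<exists>a\<in>A. \<exists>b\<in>B. \<exists>u v. x = [a] \<and> y = [b] \<and> q = Rest u v \<and> overhang (f [a]) (g [b]) u v)"
  using f_eq_Nil_iff[of "[_]"] g_eq_Nil_iff[of "[_]"]
  by (auto simp: fibre_automaton_def transitions_def overhang_iff_left_quotient)

lemma trans_pending_left_iff:
  assumes "u \<noteq> []" and "Rest u [] \<in> states M"
  shows "(Rest u [], (x, y), q) \<in> trans M \<longleftrightarrow>
     (\<exists>b\<in>B. \<exists>u' v'. x = [] \<and> y = [b] \<and> q = Rest u' v' \<and> overhang u (g [b]) u' v')"
proof -
  have "Rest u [] \<in> Q\<^sub>1 A C f"
    using assms by (auto simp: fibre_automaton_def Q\<^sub>2_def)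
  with assms(1) show ?thesis
    by (auto simp: fibre_automaton_def transitions_def overhang_iff_left_quotient)
qed

lemma trans_pending_right_iff:
  assumes "v \<noteq> []" and "Rest [] v \<in> states M"
  shows "(Rest [] v, (x, y), q) \<in> trans M \<longleftrightarrow>
     (\<exists>a\<in>A. \<exists>u' v'. x = [a] \<and> y = [] \<and> q = Rest u' v' \<and> overhang (f [a]) v u' v')"
proof -
  have "Rest [] v \<in> Q\<^sub>2 B C g"
    using assms by (auto simp: fibre_automaton_def Q\<^sub>1_def)
  with assms(1) show ?thesis
    by (auto simp: fibre_automaton_def transitions_def overhang_iff_left_quotient)
qed

lemma no_trans_from_final: "(Rest [] [], \<sigma>, q) \<notin> trans M"
  by (auto simp: fibre_automaton_def transitions_def)

lemma overhang_step_in_states: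
  shows "u \<noteq> [] \<Longrightarrow> Rest u [] \<in> states M \<Longrightarrow> b \<in> B \<Longrightarrow> overhang u (g [b]) u' v' \<Longrightarrow> Rest u' v' \<in> states M"
    and "v \<noteq> [] \<Longrightarrow> Rest [] v \<in> states M \<Longrightarrow> a \<in> A \<Longrightarrow> overhang (f [a]) v u' v' \<Longrightarrow> Rest u' v' \<in> states M"
    and "a \<in> A \<Longrightarrow> b \<in> B \<Longrightarrow> overhang (f [a]) (g [b]) u' v' \<Longrightarrow> Rest u' v' \<in> states M"
    apply (rule trans_target_in_states, subst trans_pending_left_iff; blast)
   apply (rule trans_target_in_states, subst trans_pending_right_iff; blast)
  apply (rule trans_target_in_states, subst trans_Init_iff; blast)
  done

lemma accepted_from_Init_iff:
  "accepted_from M Init \<alpha> \<beta> \<longleftrightarrow>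
     (\<exists>a\<in>A. \<exists>b\<in>B. \<exists>\<alpha>' \<beta>' u v. \<alpha> = a # \<alpha>' \<and> \<beta> = b # \<beta>' \<and> overhang (f [a]) (g [b]) u v \<and>
        Rest u v \<in> states M \<and> accepted_from M (Rest u v) \<alpha>' \<beta>')"
  (is "_ \<longleftrightarrow> ?R")
proof
  assume "accepted_from M Init \<alpha> \<beta>"
  then show ?R
  proof cases
    case (step x y q' \<alpha>' \<beta>')
    then show ?thesis
      unfolding trans_Init_iff using overhang_step_in_states(3) by fastforce
  qed (simp add: final_M)
next
  assume ?R
  then obtain a b \<alpha>' \<beta>' u v where *: "\<alpha> = a # \<alpha>'" "\<beta> = b # \<beta>'" "accepted_from M (Rest u v) \<alpha>' \<beta>'"
      "a \<in> A" "b \<in> B" "overhang (f [a]) (g [b]) u v"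
    by blast
  then have "(Init, ([a], [b]), Rest u v) \<in> trans M"
    by (simp add: trans_Init_iff)
  from accepted_from.step[OF this *(3)] show "accepted_from M Init \<alpha> \<beta>"
    by (simp add: *)
qed

lemma accepted_from_pending_left_iff:
  assumes "u \<noteq> []" and "Rest u [] \<in> states M"
  shows "accepted_from M (Rest u []) \<alpha> \<beta> \<longleftrightarrow>
     (\<exists>b\<in>B. \<exists>\<beta>' u' v'. \<beta> = b # \<beta>' \<and> overhang u (g [b]) u' v' \<and>
        Rest u' v' \<in> states M \<and> accepted_from M (Rest u' v') \<alpha> \<beta>')"
  (is "_ \<longleftrightarrow> ?R")
proof
  assume "accepted_from M (Rest u []) \<alpha> \<beta>"
  then show ?R
  proof cases
    case (step x y q' \<alpha>' \<beta>')
    then show ?thesis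
      unfolding trans_pending_left_iff[OF assms] using overhang_step_in_states(1)[OF assms] by fastforce
  qed (use assms in \<open>simp add: final_M\<close>)
next
  assume ?R
  then obtain b \<beta>' u' v' where *: "\<beta> = b # \<beta>'" "accepted_from M (Rest u' v') \<alpha> \<beta>'"
      "b \<in> B" "overhang u (g [b]) u' v'"
    by blast
  then have "(Rest u [], ([], [b]), Rest u' v') \<in> trans M"
    by (simp add: trans_pending_left_iff[OF assms])
  from accepted_from.step[OF this *(2)] show "accepted_from M (Rest u []) \<alpha> \<beta>"
    by (simp add: *)
qed

lemma accepted_from_pending_right_iff:
  assumes "v \<noteq> []" and "Rest [] v \<in> states M"
  shows "accepted_from M (Rest [] v) \<alpha> \<beta> \<longleftrightarrow>
     (\<exists>a\<in>A. \<exists>\<alpha>' u' v'. \<alpha> = a # \<alpha>' \<and> overhang (f [a]) v u' v' \<and>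
        Rest u' v' \<in> states M \<and> accepted_from M (Rest u' v') \<alpha>' \<beta>)"
  (is "_ \<longleftrightarrow> ?R")
proof
  assume "accepted_from M (Rest [] v) \<alpha> \<beta>"
  then show ?R
  proof cases
    case (step x y q' \<alpha>' \<beta>')
    then show ?thesis
      unfolding trans_pending_right_iff[OF assms] using overhang_step_in_states(2)[OF assms] by fastforce
  qed (use assms in \<open>simp add: final_M\<close>)
next
  assume ?R
  then obtain a \<alpha>' u' v' where *: "\<alpha> = a # \<alpha>'" "accepted_from M (Rest u' v') \<alpha>' \<beta>"
      "a \<in> A" "overhang (f [a]) v u' v'"
    by blast
  then have "(Rest [] v, ([a], []), Rest u' v') \<in> trans M"
    by (simp add: trans_pending_right_iff[OF assms])
  from accepted_from.step[OF this *(2)] show "accepted_from M (Rest [] v) \<alpha> \<beta>"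
    by (simp add: *)
qed

lemma accepted_from_final_iff: "accepted_from M (Rest [] []) \<alpha> \<beta> \<longleftrightarrow> \<alpha> = [] \<and> \<beta> = []"
  by (subst accepted_from.simps) (auto simp: final_M no_trans_from_final)

section \<open>Completing an overhang for the first time\<close>

definition first_match :: "'c list \<Rightarrow> 'c list \<Rightarrow> 'a list \<Rightarrow> 'b list \<Rightarrow> bool" where
  "first_match u v \<alpha> \<beta> \<longleftrightarrow> u @ f \<alpha> = v @ g \<beta> \<and>
     (\<forall>\<alpha>\<^sub>1 \<alpha>\<^sub>2 \<beta>\<^sub>1 \<beta>\<^sub>2. \<alpha> = \<alpha>\<^sub>1 @ \<alpha>\<^sub>2 \<longrightarrow> \<beta> = \<beta>\<^sub>1 @ \<beta>\<^sub>2 \<longrightarrow> u @ f \<alpha>\<^sub>1 = v @ g \<beta>\<^sub>1 \<longrightarrow> \<alpha>\<^sub>2 = [] \<and> \<beta>\<^sub>2 = [])"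

lemma first_match_Nil_iff: "first_match [] [] \<alpha> \<beta> \<longleftrightarrow> \<alpha> = [] \<and> \<beta> = []"
proof
  assume "first_match [] [] \<alpha> \<beta>"
  then have "[] @ f [] = [] @ g [] \<longrightarrow> \<alpha> = [] \<and> \<beta> = []"
    unfolding first_match_def by (metis append_Nil)
  then show "\<alpha> = [] \<and> \<beta> = []"
    by (simp add: f_Nil g_Nil)
qed (simp add: first_match_def f_Nil g_Nil)

text \<open>
  A match inside \<open>(\<alpha>, b # \<beta>)\<close> cannot leave \<open>b\<close> unread, because the first tape already contributes
  the non-empty word \<open>u\<close>. So the matches on both sides correspond under cancellation.
\<close>

lemma first_match_pending_left:
  assumes "u \<noteq> []" and "b \<in> B" and "\<beta> \<in> lists B" and ov: "overhang u (g [b]) u' v'"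
  shows "first_match u [] \<alpha> (b # \<beta>) \<longleftrightarrow> first_match u' v' \<alpha> \<beta>"
proof -
  have shift: "u @ f \<alpha>' = [] @ g (b # \<beta>') \<longleftrightarrow> u' @ f \<alpha>' = v' @ g \<beta>'" if "\<beta>' \<in> lists B" for \<alpha>' \<beta>'
    using overhang_cancel[OF ov] g_Cons[OF \<open>b \<in> B\<close> that] by simp
  have empty: "u @ f \<alpha>' \<noteq> [] @ g []" for \<alpha>'
    using \<open>u \<noteq> []\<close> by (simp add: g_Nil)
  show ?thesis
  proof
    assume L: "first_match u [] \<alpha> (b # \<beta>)"
    show "first_match u' v' \<alpha> \<beta>"
      unfolding first_match_def
    proof (rule conjI; (intro allI impI)?)
      show "u' @ f \<alpha> = v' @ g \<beta>"
        using L shift[OF \<open>\<beta> \<in> lists B\<close>] unfolding first_match_def by blast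
      fix \<alpha>\<^sub>1 \<alpha>\<^sub>2 \<beta>\<^sub>1 \<beta>\<^sub>2
      assume eq: "\<alpha> = \<alpha>\<^sub>1 @ \<alpha>\<^sub>2" "\<beta> = \<beta>\<^sub>1 @ \<beta>\<^sub>2" "u' @ f \<alpha>\<^sub>1 = v' @ g \<beta>\<^sub>1"
      then have "u @ f \<alpha>\<^sub>1 = [] @ g (b # \<beta>\<^sub>1)"
        using shift[of \<beta>\<^sub>1] \<open>\<beta> \<in> lists B\<close> by simp
      moreover have "b # \<beta> = (b # \<beta>\<^sub>1) @ \<beta>\<^sub>2"
        using eq by simp
      ultimately show "\<alpha>\<^sub>2 = [] \<and> \<beta>\<^sub>2 = []"
        using L eq(1) unfolding first_match_def by blast
    qed
  next
    assume R: "first_match u' v' \<alpha> \<beta>"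
    show "first_match u [] \<alpha> (b # \<beta>)"
      unfolding first_match_def
    proof (rule conjI; (intro allI impI)?)
      show "u @ f \<alpha> = [] @ g (b # \<beta>)"
        using R shift[OF \<open>\<beta> \<in> lists B\<close>] unfolding first_match_def by blast
      fix \<alpha>\<^sub>1 \<alpha>\<^sub>2 \<beta>\<^sub>1 \<beta>\<^sub>2
      assume eq: "\<alpha> = \<alpha>\<^sub>1 @ \<alpha>\<^sub>2" "b # \<beta> = \<beta>\<^sub>1 @ \<beta>\<^sub>2" "u @ f \<alpha>\<^sub>1 = [] @ g \<beta>\<^sub>1"
      then obtain \<beta>' where \<beta>': "\<beta>\<^sub>1 = b # \<beta>'" "\<beta> = \<beta>' @ \<beta>\<^sub>2"
        using empty by (cases \<beta>\<^sub>1) auto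
      then have "u' @ f \<alpha>\<^sub>1 = v' @ g \<beta>'"
        using shift[of \<beta>' \<alpha>\<^sub>1] eq(3) \<open>\<beta> \<in> lists B\<close> by simp
      then show "\<alpha>\<^sub>2 = [] \<and> \<beta>\<^sub>2 = []"
        using R eq(1) \<beta>'(2) unfolding first_match_def by blast
    qed
  qed
qed

lemma first_match_pending_right:
  assumes "v \<noteq> []" and "a \<in> A" and "\<alpha> \<in> lists A" and ov: "overhang (f [a]) v u' v'"
  shows "first_match [] v (a # \<alpha>) \<beta> \<longleftrightarrow> first_match u' v' \<alpha> \<beta>"
proof -
  have shift: "[] @ f (a # \<alpha>') = v @ g \<beta>' \<longleftrightarrow> u' @ f \<alpha>' = v' @ g \<beta>'" if "\<alpha>' \<in> lists A" for \<alpha>' \<beta>'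
    using overhang_cancel[OF ov] f_Cons[OF \<open>a \<in> A\<close> that] by simp
  have empty: "[] @ f [] \<noteq> v @ g \<beta>'" for \<beta>'
    using \<open>v \<noteq> []\<close> by (simp add: f_Nil)
  show ?thesis
  proof
    assume L: "first_match [] v (a # \<alpha>) \<beta>"
    show "first_match u' v' \<alpha> \<beta>"
      unfolding first_match_def
    proof (rule conjI; (intro allI impI)?)
      show "u' @ f \<alpha> = v' @ g \<beta>"
        using L shift[OF \<open>\<alpha> \<in> lists A\<close>] unfolding first_match_def by blast
      fix \<alpha>\<^sub>1 \<alpha>\<^sub>2 \<beta>\<^sub>1 \<beta>\<^sub>2
      assume eq: "\<alpha> = \<alpha>\<^sub>1 @ \<alpha>\<^sub>2" "\<beta> = \<beta>\<^sub>1 @ \<beta>\<^sub>2" "u' @ f \<alpha>\<^sub>1 = v' @ g \<beta>\<^sub>1"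
      then have "[] @ f (a # \<alpha>\<^sub>1) = v @ g \<beta>\<^sub>1"
        using shift[of \<alpha>\<^sub>1] \<open>\<alpha> \<in> lists A\<close> by simp
      moreover have "a # \<alpha> = (a # \<alpha>\<^sub>1) @ \<alpha>\<^sub>2"
        using eq by simp
      ultimately show "\<alpha>\<^sub>2 = [] \<and> \<beta>\<^sub>2 = []"
        using L eq(2) unfolding first_match_def by blast
    qed
  next
    assume R: "first_match u' v' \<alpha> \<beta>"
    show "first_match [] v (a # \<alpha>) \<beta>"
      unfolding first_match_def
    proof (rule conjI; (intro allI impI)?)
      show "[] @ f (a # \<alpha>) = v @ g \<beta>"
        using R shift[OF \<open>\<alpha> \<in> lists A\<close>] unfolding first_match_def by blast
      fix \<alpha>\<^sub>1 \<alpha>\<^sub>2 \<beta>\<^sub>1 \<beta>\<^sub>2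
      assume eq: "a # \<alpha> = \<alpha>\<^sub>1 @ \<alpha>\<^sub>2" "\<beta> = \<beta>\<^sub>1 @ \<beta>\<^sub>2" "[] @ f \<alpha>\<^sub>1 = v @ g \<beta>\<^sub>1"
      then obtain \<alpha>' where \<alpha>': "\<alpha>\<^sub>1 = a # \<alpha>'" "\<alpha> = \<alpha>' @ \<alpha>\<^sub>2"
        using empty by (cases \<alpha>\<^sub>1) auto
      then have "u' @ f \<alpha>' = v' @ g \<beta>\<^sub>1"
        using shift[of \<alpha>' \<beta>\<^sub>1] eq(3) \<open>\<alpha> \<in> lists A\<close> by simp
      then show "\<alpha>\<^sub>2 = [] \<and> \<beta>\<^sub>2 = []"
        using R eq(2) \<alpha>'(2) unfolding first_match_def by blast
    qed
  qed
qed

lemma first_match_pending_left_cases: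
  assumes "first_match u [] \<alpha> \<beta>" and "u \<noteq> []" and "\<beta> \<in> lists B"
  obtains b \<beta>' u' v' where "\<beta> = b # \<beta>'" "overhang u (g [b]) u' v'"
proof -
  have eq: "u @ f \<alpha> = g \<beta>"
    using assms(1) by (simp add: first_match_def)
  with assms(2) obtain b \<beta>' where \<beta>: "\<beta> = b # \<beta>'"
    by (cases \<beta>) (auto simp: g_Nil)
  with eq assms(3) have "u @ f \<alpha> = g [b] @ g \<beta>'"
    using g_Cons[of b \<beta>'] by simp
  then show thesis
    by (rule ex_overhang) (use \<beta> that in blast)
qed

lemma first_match_pending_right_cases:
  assumes "first_match [] v \<alpha> \<beta>" and "v \<noteq> []" and "\<alpha> \<in> lists A"
  obtains a \<alpha>' u' v' where "\<alpha> = a # \<alpha>'" "overhang (f [a]) v u' v'"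
proof -
  have eq: "f \<alpha> = v @ g \<beta>"
    using assms(1) by (simp add: first_match_def)
  with assms(2) obtain a \<alpha>' where \<alpha>: "\<alpha> = a # \<alpha>'"
    by (cases \<alpha>) (auto simp: f_Nil)
  with eq assms(3) have "f [a] @ f \<alpha>' = v @ g \<beta>"
    using f_Cons[of a \<alpha>'] by simp
  then show thesis
    by (rule ex_overhang) (use \<alpha> that in blast)
qed

text \<open>
  Each transition out of a state \<open>Rest u v\<close> consumes exactly one letter, so the number of unread
  letters serves as induction measure for both directions at once.
\<close>

lemma accepted_from_Rest_iff:
  assumes "Rest u v \<in> states M" and "\<alpha> \<in> lists A" and "\<beta> \<in> lists B"
  shows "accepted_from M (Rest u v) \<alpha> \<beta> \<longleftrightarrow> first_match u v \<alpha> \<beta>"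
  using assms
proof (induction "length \<alpha> + length \<beta>" arbitrary: u v \<alpha> \<beta> rule: less_induct)
  case less
  consider "u = []" "v = []" | "u \<noteq> []" "v = []" | "u = []" "v \<noteq> []"
    using less.prems(1) by (auto simp: fibre_automaton_def Q\<^sub>1_def Q\<^sub>2_def)
  then show ?case
  proof cases
    case 1
    then show ?thesis by (simp add: accepted_from_final_iff first_match_Nil_iff)
  next
    case 2
    have st: "Rest u [] \<in> states M"
      using less.prems(1) 2 by simp
    have step: "accepted_from M (Rest u' v') \<alpha> \<beta>' \<longleftrightarrow> first_match u [] \<alpha> \<beta>"
      if "\<beta> = b # \<beta>'" "overhang u (g [b]) u' v'" for b \<beta>' u' v'
      using less.hyps[of \<alpha> \<beta>' u' v'] less.prems that 2(1) st
        overhang_step_in_states(1)[of u b u' v'] first_match_pending_left[of u b \<beta>' u' v' \<alpha>]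
      by simp
    show ?thesis
    proof
      assume "accepted_from M (Rest u v) \<alpha> \<beta>"
      then show "first_match u v \<alpha> \<beta>"
        using accepted_from_pending_left_iff[OF 2(1) st] step 2(2) by blast
    next
      assume fm: "first_match u v \<alpha> \<beta>"
      then obtain b \<beta>' u' v' where b: "\<beta> = b # \<beta>'" "overhang u (g [b]) u' v'"
        using first_match_pending_left_cases 2 less.prems(3) by blast
      moreover have "b \<in> B"
        using b(1) less.prems(3) by simp
      ultimately show "accepted_from M (Rest u v) \<alpha> \<beta>"
        using accepted_from_pending_left_iff[OF 2(1) st] step[OF b] fm 2
          overhang_step_in_states(1)[OF 2(1) st] by blast
    qed
  next
    case 3
    have st: "Rest [] v \<in> states M"
      using less.prems(1) 3 by simp
    have step: "accepted_from M (Rest u' v') \<alpha>' \<beta> \<longleftrightarrow> first_match [] v \<alpha> \<beta>"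
      if "\<alpha> = a # \<alpha>'" "overhang (f [a]) v u' v'" for a \<alpha>' u' v'
      using less.hyps[of \<alpha>' \<beta> u' v'] less.prems that 3(2) st
        overhang_step_in_states(2)[of v a u' v'] first_match_pending_right[of v a \<alpha>' u' v' \<beta>]
      by simp
    show ?thesis
    proof
      assume "accepted_from M (Rest u v) \<alpha> \<beta>"
      then show "first_match u v \<alpha> \<beta>"
        using accepted_from_pending_right_iff[OF 3(2) st] step 3(1) by blast
    next
      assume fm: "first_match u v \<alpha> \<beta>"
      then obtain a \<alpha>' u' v' where a: "\<alpha> = a # \<alpha>'" "overhang (f [a]) v u' v'"
        using first_match_pending_right_cases 3 less.prems(2) by blast
      moreover have "a \<in> A"
        using a(1) less.prems(2) by simp
      ultimately show "accepted_from M (Rest u v) \<alpha> \<beta>"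
        using accepted_from_pending_right_iff[OF 3(2) st] step[OF a] fm 3
          overhang_step_in_states(2)[OF 3(2) st] by blast
    qed
  qed
qed

section \<open>Indecomposable elements of the fibre product\<close>

lemma in_carrier_fibre_product_iff:
  "(\<alpha>, \<beta>) \<in> carrier (fibre_product A B f g) \<longleftrightarrow>
     \<alpha> \<in> lists A - {[]} \<and> \<beta> \<in> lists B - {[]} \<and> f \<alpha> = g \<beta>"
  by (simp add: fibre_product_def free_semigroup_def)

lemma mult_fibre_product:
  "(\<alpha>\<^sub>1, \<beta>\<^sub>1) \<otimes>\<^bsub>fibre_product A B f g\<^esub> (\<alpha>\<^sub>2, \<beta>\<^sub>2) = (\<alpha>\<^sub>1 @ \<alpha>\<^sub>2, \<beta>\<^sub>1 @ \<beta>\<^sub>2)"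
  by (simp add: fibre_product_def free_semigroup_def DirProd_def)

lemma indecomposable_fibre_product_iff:
  "indecomposable (fibre_product A B f g) (\<alpha>, \<beta>) \<longleftrightarrow>
     \<alpha> \<in> lists A - {[]} \<and> \<beta> \<in> lists B - {[]} \<and> f \<alpha> = g \<beta> \<and>
     (\<forall>\<alpha>\<^sub>1 \<alpha>\<^sub>2 \<beta>\<^sub>1 \<beta>\<^sub>2. \<alpha> = \<alpha>\<^sub>1 @ \<alpha>\<^sub>2 \<longrightarrow> \<beta> = \<beta>\<^sub>1 @ \<beta>\<^sub>2 \<longrightarrow> \<alpha>\<^sub>1 \<noteq> [] \<longrightarrow> \<beta>\<^sub>1 \<noteq> [] \<longrightarrow> f \<alpha>\<^sub>1 = g \<beta>\<^sub>1 \<longrightarrow>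
        \<alpha>\<^sub>2 = [] \<and> \<beta>\<^sub>2 = [])"
  (is "?L \<longleftrightarrow> ?R")
proof
  assume ?L
  then have in_carrier: "\<alpha> \<in> lists A - {[]}" "\<beta> \<in> lists B - {[]}" "f \<alpha> = g \<beta>"
    unfolding indecomposable_def in_carrier_fibre_product_iff by blast+
  have "\<alpha>\<^sub>2 = [] \<and> \<beta>\<^sub>2 = []"
    if eq: "\<alpha> = \<alpha>\<^sub>1 @ \<alpha>\<^sub>2" "\<beta> = \<beta>\<^sub>1 @ \<beta>\<^sub>2" "\<alpha>\<^sub>1 \<noteq> []" "\<beta>\<^sub>1 \<noteq> []" "f \<alpha>\<^sub>1 = g \<beta>\<^sub>1"
    for \<alpha>\<^sub>1 \<alpha>\<^sub>2 \<beta>\<^sub>1 \<beta>\<^sub>2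
  proof -
    have ls: "\<alpha>\<^sub>1 \<in> lists A" "\<alpha>\<^sub>2 \<in> lists A" "\<beta>\<^sub>1 \<in> lists B" "\<beta>\<^sub>2 \<in> lists B"
      using in_carrier eq by auto
    \<comment> \<open>Equality of the remaining images comes from cancellation; as nothing is erased, the two
        remaining words are empty together or non-empty together.\<close>
    have "f \<alpha>\<^sub>2 = g \<beta>\<^sub>2"
      using in_carrier(3) eq f_append[OF ls(1,2)] g_append[OF ls(3,4)] by simp
    moreover have "\<not> ((\<alpha>\<^sub>1, \<beta>\<^sub>1) \<in> carrier (fibre_product A B f g) \<and>
        (\<alpha>\<^sub>2, \<beta>\<^sub>2) \<in> carrier (fibre_product A B f g))"
      using \<open>?L\<close> eq mult_fibre_product[of \<alpha>\<^sub>1 \<beta>\<^sub>1 \<alpha>\<^sub>2 \<beta>\<^sub>2] unfolding indecomposable_def by metis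
    ultimately show ?thesis
      using ls eq(3-5) f_eq_Nil_iff[OF ls(2)] g_eq_Nil_iff[OF ls(4)]
      unfolding in_carrier_fibre_product_iff by auto
  qed
  with in_carrier show ?R by blast
next
  assume R: ?R
  show ?L
    unfolding indecomposable_def
  proof (intro conjI notI)
    show "(\<alpha>, \<beta>) \<in> carrier (fibre_product A B f g)"
      unfolding in_carrier_fibre_product_iff using R by blast
    assume "\<exists>s\<^sub>1\<in>carrier (fibre_product A B f g). \<exists>s\<^sub>2\<in>carrier (fibre_product A B f g).
      (\<alpha>, \<beta>) = s\<^sub>1 \<otimes>\<^bsub>fibre_product A B f g\<^esub> s\<^sub>2"
    then obtain \<alpha>\<^sub>1 \<beta>\<^sub>1 \<alpha>\<^sub>2 \<beta>\<^sub>2 where "(\<alpha>\<^sub>1, \<beta>\<^sub>1) \<in> carrier (fibre_product A B f g)"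
        "(\<alpha>\<^sub>2, \<beta>\<^sub>2) \<in> carrier (fibre_product A B f g)" "\<alpha> = \<alpha>\<^sub>1 @ \<alpha>\<^sub>2" "\<beta> = \<beta>\<^sub>1 @ \<beta>\<^sub>2"
      by (auto simp: mult_fibre_product)
    with R show False
      unfolding in_carrier_fibre_product_iff by blast
  qed
qed

text \<open>
  The initial transition reads one letter on each tape, which is exactly the condition that the
  first factor of a decomposition be non-empty on both tapes.
\<close>

lemma indecomposable_Cons_iff:
  assumes a: "a \<in> A" and b: "b \<in> B" and \<alpha>: "\<alpha> \<in> lists A" and \<beta>: "\<beta> \<in> lists B"
    and ov: "overhang (f [a]) (g [b]) u v"
  shows "indecomposable (fibre_product A B f g) (a # \<alpha>, b # \<beta>) \<longleftrightarrow> first_match u v \<alpha> \<beta>"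
proof -
  have shift: "f (a # \<alpha>') = g (b # \<beta>') \<longleftrightarrow> u @ f \<alpha>' = v @ g \<beta>'"
    if "\<alpha>' \<in> lists A" "\<beta>' \<in> lists B" for \<alpha>' \<beta>'
    using overhang_cancel[OF ov] f_Cons[OF a that(1)] g_Cons[OF b that(2)] by simp
  have "(\<forall>\<alpha>\<^sub>1 \<alpha>\<^sub>2 \<beta>\<^sub>1 \<beta>\<^sub>2. a # \<alpha> = \<alpha>\<^sub>1 @ \<alpha>\<^sub>2 \<longrightarrow> b # \<beta> = \<beta>\<^sub>1 @ \<beta>\<^sub>2 \<longrightarrow> \<alpha>\<^sub>1 \<noteq> [] \<longrightarrow> \<beta>\<^sub>1 \<noteq> [] \<longrightarrow>
        f \<alpha>\<^sub>1 = g \<beta>\<^sub>1 \<longrightarrow> \<alpha>\<^sub>2 = [] \<and> \<beta>\<^sub>2 = []) \<longleftrightarrow>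
      (\<forall>\<alpha>\<^sub>1 \<alpha>\<^sub>2 \<beta>\<^sub>1 \<beta>\<^sub>2. \<alpha> = \<alpha>\<^sub>1 @ \<alpha>\<^sub>2 \<longrightarrow> \<beta> = \<beta>\<^sub>1 @ \<beta>\<^sub>2 \<longrightarrow>
        f (a # \<alpha>\<^sub>1) = g (b # \<beta>\<^sub>1) \<longrightarrow> \<alpha>\<^sub>2 = [] \<and> \<beta>\<^sub>2 = [])"
    by (simp add: Cons_eq_append_conv) blast
  also have "\<dots> \<longleftrightarrow> (\<forall>\<alpha>\<^sub>1 \<alpha>\<^sub>2 \<beta>\<^sub>1 \<beta>\<^sub>2. \<alpha> = \<alpha>\<^sub>1 @ \<alpha>\<^sub>2 \<longrightarrow> \<beta> = \<beta>\<^sub>1 @ \<beta>\<^sub>2 \<longrightarrow>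
        u @ f \<alpha>\<^sub>1 = v @ g \<beta>\<^sub>1 \<longrightarrow> \<alpha>\<^sub>2 = [] \<and> \<beta>\<^sub>2 = [])"
    using shift \<alpha> \<beta> by (metis append_in_lists_conv)
  finally show ?thesis
    using assms shift[OF \<alpha> \<beta>] by (simp add: indecomposable_fibre_product_iff first_match_def)
qed

theorem language_eq_indecomposable:
  "language M = {s. indecomposable (fibre_product A B f g) s}"
proof -
  have alph: "alphabet\<^sub>1 M = A" "alphabet\<^sub>2 M = B"
    by (simp_all add: fibre_automaton_def)
  have "\<alpha> \<in> lists A \<and> \<beta> \<in> lists B \<and> accepted_from M Init \<alpha> \<beta> \<longleftrightarrow>
      indecomposable (fibre_product A B f g) (\<alpha>, \<beta>)" (is "?L \<longleftrightarrow> ?R") for \<alpha> \<beta>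
  proof
    assume L: ?L
    then have "accepted_from M Init \<alpha> \<beta>"
      by blast
    then obtain a b \<alpha>' \<beta>' u v where *: "a \<in> A" "b \<in> B" "\<alpha> = a # \<alpha>'" "\<beta> = b # \<beta>'"
        "overhang (f [a]) (g [b]) u v" "Rest u v \<in> states M" "accepted_from M (Rest u v) \<alpha>' \<beta>'"
      unfolding accepted_from_Init_iff by blast
    moreover from L have "\<alpha>' \<in> lists A" "\<beta>' \<in> lists B"
      using * by simp_all
    ultimately show ?R
      using accepted_from_Rest_iff indecomposable_Cons_iff by simp
  next
    assume R: ?R
    then have ls: "\<alpha> \<in> lists A - {[]}" "\<beta> \<in> lists B - {[]}" and eq: "f \<alpha> = g \<beta>"
      unfolding indecomposable_fibre_product_iff by blast+
    then obtain a \<alpha>' b \<beta>' where Cons: "\<alpha> = a # \<alpha>'" "\<beta> = b # \<beta>'"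
      by (metis DiffE insertI1 neq_Nil_conv)
    with ls have in_alph: "a \<in> A" "\<alpha>' \<in> lists A" "b \<in> B" "\<beta>' \<in> lists B"
      by simp_all
    with eq Cons have "f [a] @ f \<alpha>' = g [b] @ g \<beta>'"
      using f_Cons[of a \<alpha>'] g_Cons[of b \<beta>'] by simp
    then obtain u v where ov: "overhang (f [a]) (g [b]) u v"
      by (rule ex_overhang)
    then have st: "Rest u v \<in> states M"
      using overhang_step_in_states(3) in_alph by blast
    moreover have "accepted_from M (Rest u v) \<alpha>' \<beta>'"
      using accepted_from_Rest_iff[OF st in_alph(2,4)] R Cons
        indecomposable_Cons_iff[OF in_alph(1,3,2,4) ov] by simp
    ultimately have "accepted_from M Init \<alpha> \<beta>"
      using accepted_from_Init_iff in_alph Cons ov by blast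
    with ls show ?L by simp
  qed
  then show ?thesis
    by (simp add: language_def set_eq_iff accepts_iff_accepted_from initial_M alph
        del: in_lists_conv_set)
qed

end

section \<open>Extensions of semigroup epimorphisms\<close>

text \<open>
  A homomorphism of free semigroups has non-empty values, so its extension to the free monoids
  erases no non-empty word.
\<close>

lemma monoid_extension_eq_Nil_iff:
  assumes "\<phi> \<in> epi (free_semigroup A) (free_semigroup C)" and "\<alpha> \<in> lists A"
  shows "monoid_extension \<phi> \<alpha> = [] \<longleftrightarrow> \<alpha> = []"
  using assms
  by (auto simp: monoid_extension_def epi_def hom_def free_semigroup_def Pi_iff
      simp del: in_lists_conv_set)

lemma fibre_product_monoid_extension:
  "fibre_product A B (monoid_extension \<phi>) (monoid_extension \<psi>) = fibre_product A B \<phi> \<psi>"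
proof -
  have "{(\<alpha>, \<beta>). \<alpha> \<in> carrier (free_semigroup A) \<and> \<beta> \<in> carrier (free_semigroup B) \<and>
          monoid_extension \<phi> \<alpha> = monoid_extension \<psi> \<beta>} =
      {(\<alpha>, \<beta>). \<alpha> \<in> carrier (free_semigroup A) \<and> \<beta> \<in> carrier (free_semigroup B) \<and> \<phi> \<alpha> = \<psi> \<beta>}"
    by (auto simp: monoid_extension_def free_semigroup_def)
  then show ?thesis
    by (simp only: fibre_product_def)
qed

theorem corollary5p11:
  fixes A :: "'a set" and B :: "'b set" and C :: "'c set"
    and \<phi> :: "'a list \<Rightarrow> 'c list" and \<psi> :: "'b list \<Rightarrow> 'c list"
  assumes "finite A" and "finite B" and "finite C"
    and "\<phi> \<in> epi (free_semigroup A) (free_semigroup C)"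
    and "\<psi> \<in> epi (free_semigroup B) (free_semigroup C)"
  shows "language (fibre_automaton A B C (monoid_extension \<phi>) (monoid_extension \<psi>))
    = {s. indecomposable (fibre_product A B \<phi> \<psi>) s}"
proof -
  interpret nonerasing_pair A B C "monoid_extension \<phi>" "monoid_extension \<psi>"
    by unfold_locales
      (use assms monoid_extension_epi monoid_extension_eq_Nil_iff in blast)+
  show ?thesis
    using language_eq_indecomposable by (simp only: fibre_product_monoid_extension)
qed

end
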